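(* Let $\Phi$ be a holomorphic function on a simply connected domain $D\subset\mathbb{C}$, let $\lambda\in\mathbb{C}$, and define $$X(\omega)=\operatorname{Re}\bigl(k_1(\omega),k_2(\omega),k_3(\omega),k_4(\omega)\bigr),$$ where $$k_1=\tfrac12\bigl(1-(1+\lambda^2)\omega^2\bigr)\Phi''+(1+\lambda^2)\omega\Phi'-(1+\lambda^2)\Phi,$$ $$k_2=\tfrac{\mathrm i}{2}\bigl(1+(1+\lambda^2)\omega^2\bigr)\Phi''-\mathrm i(1+\lambda^2)\omega\Phi'+\mathrm i(1+\lambda^2)\Phi,$$ $$k_3=\omega\Phi''-\Phi',\qquad k_4=\lambda(\omega\Phi''-\Phi').$$ Then $X$ is (up to an additive constant) the integral-free form of the immersion into $\mathbb{R}^4$ derived from the single seed function $\Phi$, with Weierstrass data $f=\Phi'''$, $g(\omega)=\omega$, $h(\omega)=\lambda\omega$. The functions $k_1,\dots,k_4$ satisfy $$\Phi=\frac{(1+\lambda^2)\omega^2-1}{2(1+\lambda^2)}\,k_1-\mathrm i\,\frac{(1+\lambda^2)\omega^2+1}{2(1+\lambda^2)}\,k_2-\frac{\omega}{1+\lambda^2}\,(k_3+\lambda k_4).$$ For $\lambda=0$, $X(\omega)$ reduces to the integral-free Weierstrass form in $\mathbb{R}^3$.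
   Context: Primes denote derivatives with respect to the complex variable $\omega$. For holomorphic $f,g,h$ on a domain $D\subset\mathbb{C}$, the surface in $\mathbb{R}^4$ with Weierstrass data $(f,g,h)$ is $\operatorname{Re}\int\bigl(\tfrac12 f(1-g^2-h^2),\ \tfrac{\mathrm i}{2}f(1+g^2+h^2),\ fg,\ fh\bigr)\,d\omega$, determined up to an additive constant. The integral-free Weierstrass form in $\mathbb{R}^3$ is $\operatorname{Re}\bigl(\tfrac12(1-\omega^2)\Phi''+\omega\Phi'-\Phi,\ \tfrac{\mathrm i}{2}(1+\omega^2)\Phi''-\mathrm i\omega\Phi'+\mathrm i\Phi,\ \omega\Phi''-\Phi'\bigr)$.
   Formalization: The formula recovering Φ is stated only for 1+λ² ≠ 0, since it divides by zero at λ = ±i; X is claimed to be an immersion only at points where Φ''' ≠ 0, since its differential vanishes at zeros of Φ''' (e.g. Φ = ω²). *)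

theory Defs
  imports "HOL-Complex_Analysis.Complex_Analysis"
begin

definition weierstrass_integrand ::
    "(complex \<Rightarrow> complex) \<Rightarrow> (complex \<Rightarrow> complex) \<Rightarrow> (complex \<Rightarrow> complex) \<Rightarrow> complex \<Rightarrow> complex^4" where
  "weierstrass_integrand f g h \<omega> = vector
     [1/2 * f \<omega> * (1 - (g \<omega>)^2 - (h \<omega>)^2),
      \<i>/2 * f \<omega> * (1 + (g \<omega>)^2 + (h \<omega>)^2),
      f \<omega> * g \<omega>,
      f \<omega> * h \<omega>]"

(* "X is the surface with Weierstrass data (f, g, h)", i.e. X = Re (integral) up to an additive
   constant C. The integral from a base point must be independent of the path, so all
   paths in D are quantified after C. *)
definition has_weierstrass_data ::
    "complex set \<Rightarrow> (complex \<Rightarrow> complex) \<Rightarrow> (complex \<Rightarrow> complex) \<Rightarrow> (complex \<Rightarrow> complex)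
      \<Rightarrow> (complex \<Rightarrow> real^4) \<Rightarrow> bool" where
  "has_weierstrass_data D f g h X \<longleftrightarrow>
     f holomorphic_on D \<and> g holomorphic_on D \<and> h holomorphic_on D \<and>
     (\<forall>\<omega>\<^sub>0\<in>D. \<exists>C :: real^4. \<forall>\<gamma>.
        valid_path \<gamma> \<and> path_image \<gamma> \<subseteq> D \<and> pathstart \<gamma> = \<omega>\<^sub>0 \<longrightarrow>
        X (pathfinish \<gamma>) =
          C + (\<chi> i. Re (contour_integral \<gamma> (\<lambda>\<omega>. weierstrass_integrand f g h \<omega> $ i))))"

(* C1 with injective real differential; meant for open S. *)
definition immersion_on :: "complex set \<Rightarrow> (complex \<Rightarrow> real^4) \<Rightarrow> bool" where
  "immersion_on S X \<longleftrightarrow>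
     (\<exists>X' :: complex \<Rightarrow> complex \<Rightarrow>\<^sub>L (real^4).
        continuous_on S X' \<and>
        (\<forall>\<omega>\<in>S. (X has_derivative blinfun_apply (X' \<omega>)) (at \<omega>) \<and> inj (blinfun_apply (X' \<omega>))))"

definition k1 :: "complex \<Rightarrow> (complex \<Rightarrow> complex) \<Rightarrow> complex \<Rightarrow> complex" where
  "k1 lam \<Phi> \<omega> = 1/2 * (1 - (1 + lam^2) * \<omega>^2) * (deriv ^^ 2) \<Phi> \<omega>
     + (1 + lam^2) * \<omega> * deriv \<Phi> \<omega> - (1 + lam^2) * \<Phi> \<omega>"

definition k2 :: "complex \<Rightarrow> (complex \<Rightarrow> complex) \<Rightarrow> complex \<Rightarrow> complex" where
  "k2 lam \<Phi> \<omega> = \<i>/2 * (1 + (1 + lam^2) * \<omega>^2) * (deriv ^^ 2) \<Phi> \<omega>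
     - \<i> * (1 + lam^2) * \<omega> * deriv \<Phi> \<omega> + \<i> * (1 + lam^2) * \<Phi> \<omega>"

definition k3 :: "(complex \<Rightarrow> complex) \<Rightarrow> complex \<Rightarrow> complex" where
  "k3 \<Phi> \<omega> = \<omega> * (deriv ^^ 2) \<Phi> \<omega> - deriv \<Phi> \<omega>"

definition k4 :: "complex \<Rightarrow> (complex \<Rightarrow> complex) \<Rightarrow> complex \<Rightarrow> complex" where
  "k4 lam \<Phi> \<omega> = lam * (\<omega> * (deriv ^^ 2) \<Phi> \<omega> - deriv \<Phi> \<omega>)"

definition seed_surface :: "complex \<Rightarrow> (complex \<Rightarrow> complex) \<Rightarrow> complex \<Rightarrow> real^4" where
  "seed_surface lam \<Phi> \<omega> =
     vector [Re (k1 lam \<Phi> \<omega>), Re (k2 lam \<Phi> \<omega>), Re (k3 \<Phi> \<omega>), Re (k4 lam \<Phi> \<omega>)]"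

definition weierstrass_integral_free_R3 :: "(complex \<Rightarrow> complex) \<Rightarrow> complex \<Rightarrow> real^3" where
  "weierstrass_integral_free_R3 \<Phi> \<omega> = vector
     [Re (1/2 * (1 - \<omega>^2) * (deriv ^^ 2) \<Phi> \<omega> + \<omega> * deriv \<Phi> \<omega> - \<Phi> \<omega>),
      Re (\<i>/2 * (1 + \<omega>^2) * (deriv ^^ 2) \<Phi> \<omega> - \<i> * \<omega> * deriv \<Phi> \<omega> + \<i> * \<Phi> \<omega>),
      Re (\<omega> * (deriv ^^ 2) \<Phi> \<omega> - deriv \<Phi> \<omega>)]"

definition embed_R3 :: "real^3 \<Rightarrow> real^4" where
  "embed_R3 v = vector [v $ 1, v $ 2, v $ 3, 0]"

(* The library states this only up to dimension 3. *)
lemma vector_4 [simp]: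
  "(vector [x,y,z,w] :: ('a::zero)^4) $ 1 = x"
  "(vector [x,y,z,w] :: ('a::zero)^4) $ 2 = y"
  "(vector [x,y,z,w] :: ('a::zero)^4) $ 3 = z"
  "(vector [x,y,z,w] :: ('a::zero)^4) $ 4 = w"
  unfolding vector_def by simp_all

end

theory Submission
  imports Defs
begin

text \<open>
  The vector of coefficient functions \<open>(k1, k2, k3, k4)\<close> is a holomorphic primitive of the
  Weierstrass integrand with data \<open>(\<Phi>''', \<omega>, \<lambda>\<omega>)\<close>: on differentiating, all terms in \<open>\<Phi>'\<close> and
  \<open>\<Phi>''\<close> cancel and only multiples of \<open>\<Phi>'''\<close> survive (\<open>seed_primitive\<close>). So integrals along paths
  in \<open>D\<close> are differences of endpoint values, which is independence of the path together with the
  integral-free formula (\<open>has_weierstrass_data_primitive\<close>).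

  For the immersion property, any surface with a primitive of the Weierstrass integrand has
  differential \<open>v \<mapsto> Re (\<phi> v)\<close>, where \<open>\<phi>\<close> is the integrand. The point of the Weierstrass form is
  that \<open>\<phi>\<close> is isotropic, \<open>\<Sum> \<phi>\<^sub>i\<^sup>2 = 0\<close>. Hence \<open>\<phi> v\<close> is isotropic too, its real and imaginary parts
  have equal length, and if the real part vanishes so does \<open>\<phi> v\<close>. Since \<open>\<phi>\<^sub>1 - \<i> \<phi>\<^sub>2 = f\<close>, this
  forces \<open>v = 0\<close> wherever \<open>f \<noteq> 0\<close> (\<open>immersion_on_primitive\<close>).

  The formula recovering \<open>\<Phi>\<close> and the case \<open>\<lambda> = 0\<close> are algebraic identities in the independent
  quantities \<open>\<Phi>\<close>, \<open>\<Phi>'\<close>, \<open>\<Phi>''\<close>.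
\<close>

text \<open>
  By the fundamental theorem for contour integrals, the constant \<open>C\<close> is the value of \<open>X\<close> at the
  base point, whichever path is taken.
\<close>
lemma has_weierstrass_data_primitive:
  fixes K :: "complex \<Rightarrow> complex^4"
  assumes "f holomorphic_on D" "g holomorphic_on D" "h holomorphic_on D"
    and K: "\<And>\<omega> i. \<omega> \<in> D \<Longrightarrow>
      ((\<lambda>z. K z $ i) has_field_derivative weierstrass_integrand f g h \<omega> $ i) (at \<omega>)"
    and X: "\<And>\<omega>. X \<omega> = (\<chi> i. Re (K \<omega> $ i))"
  shows "has_weierstrass_data D f g h X"
  unfolding has_weierstrass_data_def
proof (intro conjI ballI exI allI impI)
  fix \<omega>\<^sub>0 \<gamma>
  assume \<gamma>: "valid_path \<gamma> \<and> path_image \<gamma> \<subseteq> D \<and> pathstart \<gamma> = \<omega>\<^sub>0"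
  have "contour_integral \<gamma> (\<lambda>\<omega>. weierstrass_integrand f g h \<omega> $ i) = K (pathfinish \<gamma>) $ i - K \<omega>\<^sub>0 $ i"
    for i
    using contour_integral_primitive[OF has_field_derivative_at_within[OF K], of D \<gamma>] \<gamma>
    by (metis contour_integral_unique)
  then show "X (pathfinish \<gamma>) = X \<omega>\<^sub>0 +
      (\<chi> i. Re (contour_integral \<gamma> (\<lambda>\<omega>. weierstrass_integrand f g h \<omega> $ i)))"
    by (simp add: X vec_eq_iff)
qed (use assms in auto)

text \<open>
  The first two entries contribute \<open>f\<^sup>2 ((1 - a)\<^sup>2 - (1 + a)\<^sup>2) / 4 = - f\<^sup>2 a\<close> with
  \<open>a = g\<^sup>2 + h\<^sup>2\<close>, which the last two compensate.
\<close>
lemma weierstrass_integrand_isotropic: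
  "(\<Sum>i\<in>UNIV. (weierstrass_integrand f g h \<omega> $ i)^2) = 0"
  unfolding sum_4 weierstrass_integrand_def vector_4
  by (simp add: power_mult_distrib power_divide) (simp add: field_simps power2_eq_square)

text \<open>
  For an isotropic vector \<open>x + \<i> y\<close>, the real part of \<open>\<Sum> z\<^sub>i\<^sup>2 = 0\<close> reads
  \<open>\<bar>x\<bar>\<^sup>2 = \<bar>y\<bar>\<^sup>2\<close>, so the real part alone determines whether the vector vanishes.
\<close>
lemma isotropic_eq_0_if_Re_eq_0:
  fixes z :: "complex^'n"
  assumes iso: "(\<Sum>i\<in>UNIV. (z $ i)^2) = 0" and Re0: "\<And>i. Re (z $ i) = 0"
  shows "z = 0"
proof -
  have "(\<Sum>i\<in>UNIV. (Im (z $ i))^2) = - Re (\<Sum>i\<in>UNIV. (z $ i)^2)"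
    by (simp add: Re0 sum_negf[symmetric] power2_eq_square)
  then have "(\<Sum>i\<in>UNIV. (Im (z $ i))^2) = 0"
    by (simp add: iso)
  then have "Im (z $ i) = 0" for i
    by (simp add: sum_nonneg_eq_0_iff)
  then show ?thesis
    by (simp add: vec_eq_iff complex_eq_iff Re0)
qed

text \<open>
  The differential of \<open>X\<close> at \<open>\<omega>\<close> is \<open>v \<mapsto> Re (\<phi> v)\<close> with \<open>\<phi>\<close> the integrand. A kernel vector
  gives an isotropic \<open>\<phi> v\<close> without real part, hence \<open>\<phi> v = 0\<close>; as \<open>\<phi>\<^sub>1 - \<i> \<phi>\<^sub>2 = f\<close>, the
  integrand vanishes only at zeros of \<open>f\<close>.
\<close>
lemma immersion_on_primitive:
  fixes K :: "complex \<Rightarrow> complex^4"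
  assumes cont: "continuous_on S f" "continuous_on S g" "continuous_on S h"
    and nz: "\<And>\<omega>. \<omega> \<in> S \<Longrightarrow> f \<omega> \<noteq> 0"
    and K: "\<And>\<omega> i. \<omega> \<in> S \<Longrightarrow>
      ((\<lambda>z. K z $ i) has_field_derivative weierstrass_integrand f g h \<omega> $ i) (at \<omega>)"
    and X: "\<And>\<omega>. X \<omega> = (\<chi> i. Re (K \<omega> $ i))"
  shows "immersion_on S X"
proof -
  let ?\<phi> = "weierstrass_integrand f g h"
  define dX where "dX \<omega> v = (\<chi> i. Re (?\<phi> \<omega> $ i * v))" for \<omega> v
  have bl: "bounded_linear (dX \<omega>)" for \<omega>
    unfolding dX_def
    by (intro linear_conv_bounded_linear[THEN iffD1] linearI)
       (simp_all add: vec_eq_iff algebra_simps)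
  define X' where "X' \<omega> = Blinfun (dX \<omega>)" for \<omega>
  have app: "blinfun_apply (X' \<omega>) = dX \<omega>" for \<omega>
    by (simp add: X'_def bl bounded_linear_Blinfun_apply)
  have cont_\<phi>: "continuous_on S (\<lambda>\<omega>. ?\<phi> \<omega> $ i)" for i
  proof -
    have "\<forall>i. continuous_on S (\<lambda>\<omega>. ?\<phi> \<omega> $ i)"
      unfolding forall_4 weierstrass_integrand_def vector_4
      by (intro conjI continuous_intros cont)
    then show ?thesis ..
  qed
  have "continuous_on S (\<lambda>\<omega>. blinfun_apply (X' \<omega>) v)" for v
    unfolding app dX_def
    by (intro continuous_on_vec_lambda continuous_on_Re continuous_on_mult continuous_on_const cont_\<phi>)
  then have "continuous_on S X'"
    by (rule continuous_on_blinfun_componentwise)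
  moreover have "(X has_derivative dX \<omega>) (at \<omega>)" if "\<omega> \<in> S" for \<omega>
  proof -
    have "((\<lambda>z. Re (K z $ i)) has_derivative (\<lambda>v. Re (?\<phi> \<omega> $ i * v))) (at \<omega>)" for i
      using has_derivative_Re[OF K[OF that, of i, unfolded has_field_derivative_def]] .
    then have "((\<lambda>z. \<chi> i. Re (K z $ i)) has_derivative dX \<omega>) (at \<omega>)"
      unfolding has_derivative_componentwise_within[of _ "dX \<omega>"]
      by (auto simp: Basis_vec_def inner_axis dX_def)
    then show ?thesis
      unfolding X[abs_def] .
  qed
  moreover have "inj (dX \<omega>)" if "\<omega> \<in> S" for \<omega>
  proof (subst linear_injective_0)
    show "linear (dX \<omega>)"
      using bl by (rule bounded_linear.linear)
    show "\<forall>v. dX \<omega> v = 0 \<longrightarrow> v = 0"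
    proof (intro allI impI)
      fix v assume "dX \<omega> v = 0"
      define z where "z = (\<chi> i. ?\<phi> \<omega> $ i * v)"
      have "(\<Sum>i\<in>UNIV. (z $ i)^2) = (\<Sum>i\<in>UNIV. (?\<phi> \<omega> $ i)^2) * v^2"
        by (simp add: z_def power_mult_distrib sum_distrib_right)
      then have "(\<Sum>i\<in>UNIV. (z $ i)^2) = 0"
        by (simp only: weierstrass_integrand_isotropic) simp
      moreover have "Re (z $ i) = 0" for i
        using \<open>dX \<omega> v = 0\<close> by (simp add: z_def dX_def vec_eq_iff)
      ultimately have "z = 0"
        by (rule isotropic_eq_0_if_Re_eq_0)
      then have "z $ 1 - \<i> * z $ 2 = 0"
        by simp
      moreover have "z $ 1 - \<i> * z $ 2 = f \<omega> * v"
        by (simp add: z_def weierstrass_integrand_def field_simps)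
      ultimately show "v = 0"
        using nz[OF that] by simp
    qed
  qed
  ultimately show ?thesis
    unfolding immersion_on_def by (intro exI[of _ X']) (simp add: app)
qed

definition seed_curve :: "complex \<Rightarrow> (complex \<Rightarrow> complex) \<Rightarrow> complex \<Rightarrow> complex^4" where
  "seed_curve lam \<Phi> \<omega> = vector [k1 lam \<Phi> \<omega>, k2 lam \<Phi> \<omega>, k3 \<Phi> \<omega>, k4 lam \<Phi> \<omega>]"

lemma seed_surface_eq_Re: "seed_surface lam \<Phi> \<omega> = (\<chi> i. Re (seed_curve lam \<Phi> \<omega> $ i))"
  by (simp add: seed_surface_def seed_curve_def vec_eq_iff forall_4)

lemma higher_deriv_has_field_derivative:
  assumes "open D" "\<Phi> holomorphic_on D" "\<omega> \<in> D"
  shows "((deriv ^^ n) \<Phi> has_field_derivative (deriv ^^ Suc n) \<Phi> \<omega>) (at \<omega>)"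
  using holomorphic_derivI[OF holomorphic_higher_deriv[OF assms(2,1)] assms(1,3)]
  by simp

text \<open>
  Write \<open>c = 1 + \<lambda>\<^sup>2\<close>, so that \<open>g\<^sup>2 + h\<^sup>2 = c \<omega>\<^sup>2\<close>. In the derivative of \<open>k1\<close> the terms
  \<open>- c \<omega> \<Phi>'' + c \<omega> \<Phi>''\<close> and \<open>c \<Phi>' - c \<Phi>'\<close> cancel and leave \<open>(1 - c \<omega>\<^sup>2) \<Phi>''' / 2\<close>;
  likewise for \<open>k2\<close>, and \<open>(\<omega> \<Phi>'' - \<Phi>')' = \<omega> \<Phi>'''\<close>.
\<close>
lemma seed_primitive:
  assumes "open D" "\<Phi> holomorphic_on D" "\<omega> \<in> D"
  shows "((\<lambda>z. seed_curve lam \<Phi> z $ i) has_field_derivative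
      weierstrass_integrand ((deriv ^^ 3) \<Phi>) (\<lambda>\<omega>. \<omega>) (\<lambda>\<omega>. lam * \<omega>) \<omega> $ i) (at \<omega>)"
proof -
  note d = higher_deriv_has_field_derivative[OF assms]
  have d0: "(\<Phi> has_field_derivative deriv \<Phi> \<omega>) (at \<omega>)"
    and d1: "(deriv \<Phi> has_field_derivative (deriv ^^ 2) \<Phi> \<omega>) (at \<omega>)"
    and d2: "((deriv ^^ 2) \<Phi> has_field_derivative (deriv ^^ 3) \<Phi> \<omega>) (at \<omega>)"
    using d[of 0] d[of 1] d[of 2] by (simp_all add: numeral_eq_Suc)
  have "\<forall>i. ((\<lambda>z. seed_curve lam \<Phi> z $ i) has_field_derivative
      weierstrass_integrand ((deriv ^^ 3) \<Phi>) (\<lambda>\<omega>. \<omega>) (\<lambda>\<omega>. lam * \<omega>) \<omega> $ i) (at \<omega>)"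
    unfolding forall_4 seed_curve_def weierstrass_integrand_def vector_4
      k1_def k2_def k3_def k4_def
    by (intro conjI; (rule derivative_eq_intros d0 d1 d2 refl)+;
        simp add: field_simps power2_eq_square)
  then show ?thesis ..
qed

text \<open>
  The factor \<open>\<lambda>\<close> in front of \<open>k4\<close> makes the last bracket equal to \<open>c (\<omega> \<Phi>'' - \<Phi>')\<close> with
  \<open>c = 1 + \<lambda>\<^sup>2\<close>, just what is needed to cancel the \<open>\<Phi>''\<close> and \<open>\<Phi>'\<close> terms left by \<open>k1\<close> and
  \<open>k2\<close>. The identity is pointwise: the derivatives enter as unrelated numbers.
\<close>
lemma seed_recovery:
  assumes "1 + lam^2 \<noteq> 0"
  shows "\<Phi> \<omega> = ((1 + lam^2) * \<omega>^2 - 1) / (2 * (1 + lam^2)) * k1 lam \<Phi> \<omega>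
            - \<i> * (((1 + lam^2) * \<omega>^2 + 1) / (2 * (1 + lam^2))) * k2 lam \<Phi> \<omega>
            - \<omega> / (1 + lam^2) * (k3 \<Phi> \<omega> + lam * k4 lam \<Phi> \<omega>)"
proof -
  define c where "c = 1 + lam^2"
  define A where "A = (deriv ^^ 2) \<Phi> \<omega>"
  have c: "c \<noteq> 0"
    using assms by (simp add: c_def)
  have k34: "k3 \<Phi> \<omega> + lam * k4 lam \<Phi> \<omega> = c * (\<omega> * A - deriv \<Phi> \<omega>)"
    by (simp add: k3_def k4_def c_def A_def algebra_simps power2_eq_square)
  have k2: "\<i> * k2 lam \<Phi> \<omega> =
      - (1/2 * (1 + c * \<omega>^2) * A - c * \<omega> * deriv \<Phi> \<omega> + c * \<Phi> \<omega>)"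
    by (simp add: k2_def c_def A_def algebra_simps)
  have "(c * \<omega>^2 - 1) / (2 * c) * k1 lam \<Phi> \<omega>
      - (c * \<omega>^2 + 1) / (2 * c) * (\<i> * k2 lam \<Phi> \<omega>)
      - \<omega> / c * (k3 \<Phi> \<omega> + lam * k4 lam \<Phi> \<omega>) = \<Phi> \<omega>"
    unfolding k34 k2 k1_def c_def[symmetric] A_def[symmetric]
    using c by (simp add: field_simps power2_eq_square)
  then show ?thesis
    unfolding c_def by (simp add: mult_ac)
qed

theorem mainTheorem3:
  fixes D :: "complex set" and \<Phi> :: "complex \<Rightarrow> complex" and lam :: complex
  assumes "open D" and "connected D" and "D \<noteq> {}" and "simply_connected D"
    and "\<Phi> holomorphic_on D"
  shows "has_weierstrass_data D ((deriv ^^ 3) \<Phi>) (\<lambda>\<omega>. \<omega>) (\<lambda>\<omega>. lam * \<omega>) (seed_surface lam \<Phi>)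
    \<and> immersion_on {\<omega> \<in> D. (deriv ^^ 3) \<Phi> \<omega> \<noteq> 0} (seed_surface lam \<Phi>)
    \<and> (1 + lam^2 \<noteq> 0 \<longrightarrow>
        (\<forall>\<omega>\<in>D. \<Phi> \<omega> =
            ((1 + lam^2) * \<omega>^2 - 1) / (2 * (1 + lam^2)) * k1 lam \<Phi> \<omega>
            - \<i> * (((1 + lam^2) * \<omega>^2 + 1) / (2 * (1 + lam^2))) * k2 lam \<Phi> \<omega>
            - \<omega> / (1 + lam^2) * (k3 \<Phi> \<omega> + lam * k4 lam \<Phi> \<omega>)))
    \<and> (lam = 0 \<longrightarrow>
        (\<forall>\<omega>\<in>D. seed_surface lam \<Phi> \<omega> = embed_R3 (weierstrass_integral_free_R3 \<Phi> \<omega>)))"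
proof (intro conjI impI ballI)
  have hol: "(deriv ^^ 3) \<Phi> holomorphic_on D"
    using assms(5,1) by (rule holomorphic_higher_deriv)
  note prim = seed_primitive[OF assms(1,5)]
  show "has_weierstrass_data D ((deriv ^^ 3) \<Phi>) (\<lambda>\<omega>. \<omega>) (\<lambda>\<omega>. lam * \<omega>) (seed_surface lam \<Phi>)"
    using hol prim
    by (intro has_weierstrass_data_primitive[where K = "seed_curve lam \<Phi>"] seed_surface_eq_Re)
       (auto intro!: holomorphic_intros)
  have "continuous_on {\<omega> \<in> D. (deriv ^^ 3) \<Phi> \<omega> \<noteq> 0} ((deriv ^^ 3) \<Phi>)"
    using hol by (rule continuous_on_subset[OF holomorphic_on_imp_continuous_on]) auto
  then show "immersion_on {\<omega> \<in> D. (deriv ^^ 3) \<Phi> \<omega> \<noteq> 0} (seed_surface lam \<Phi>)"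
    using prim
    by (intro immersion_on_primitive[where K = "seed_curve lam \<Phi>" and f = "(deriv ^^ 3) \<Phi>"
          and g = "\<lambda>\<omega>. \<omega>" and h = "\<lambda>\<omega>. lam * \<omega>"] seed_surface_eq_Re)
       (auto intro!: continuous_intros)
  show "seed_surface lam \<Phi> \<omega> = embed_R3 (weierstrass_integral_free_R3 \<Phi> \<omega>)" if "lam = 0" for \<omega>
    using that
    by (simp add: seed_surface_def embed_R3_def weierstrass_integral_free_R3_def
        k1_def k2_def k3_def k4_def)
qed (rule seed_recovery)

end
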